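(* Let $k\in L^1(\mathbb{R}_+;\mathbb{R})$ and let $r_k$ be the integral resolvent of $k$. Assume $r_k\in L^1(\mathbb{R}_+;\mathbb{R})$. Let $f\in L^1_{loc}(\mathbb{R}_+;\mathbb{R})$ and let $x$ be the solution of the integral equation $$x(t)=\int_0^t k(t-s)x(s)\,ds+f(t),\quad t\ge 0 .$$ Then $f\in\mathrm{Ces}(\mathbb{R}_+;\mathbb{R})$ if and only if $x\in\mathrm{Ces}(\mathbb{R}_+;\mathbb{R})$.
   Context: $\mathbb{R}_+=[0,\infty)$. $L^1_{loc}(\mathbb{R}_+;\mathbb{R})$ is the space of functions that are Lebesgue integrable on every compact subset of $\mathbb{R}_+$. Convolution of functions on $\mathbb{R}_+$ is $(g\ast h)(t)=\int_0^t g(t-s)h(s)\,ds$. The integral resolvent $r_k$ of $k$ is the solution on $\mathbb{R}_+$ of $r_k=k+r_k\ast k$; the solution of the integral equation is given by $x(t)=f(t)+(r_k\ast f)(t)$. Equalities of locally integrable functions are understood almost everywhere. The space of Cesàro functions is $$\mathrm{Ces}(\mathbb{R}_+;\mathbb{R})=\Big\{g\in L^1_{loc}(\mathbb{R}_+;\mathbb{R}):\ \lim_{t\to\infty}\frac1t\int_0^t g(s)\,ds=C\ \text{for some } C\in\mathbb{R}\Big\}.$$ *)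

theory Defs
  imports "HOL-Analysis.Analysis"
begin

text \<open>Functions on the half-line are represented by functions on \<^typ>\<open>real\<close>; only their
  values on the set of nonnegative reals are ever used, and they are compared almost everywhere.\<close>

definition L1 :: "(real \<Rightarrow> real) set" where
  "L1 = {g. set_integrable lebesgue {0..} g}"

definition L1_loc :: "(real \<Rightarrow> real) set" where
  "L1_loc = {g. \<forall>K. compact K \<and> K \<subseteq> {0..} \<longrightarrow> set_integrable lebesgue K g}"

definition ae_eq :: "(real \<Rightarrow> real) \<Rightarrow> (real \<Rightarrow> real) \<Rightarrow> bool" where
  "ae_eq g h \<longleftrightarrow> (AE t in lebesgue. t \<ge> 0 \<longrightarrow> g t = h t)"

text \<open>At points where the integrand is not integrable the Bochner integral below is \<open>0\<close> by
  convention; for locally integrable functions these points form a null set.\<close>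

definition conv :: "(real \<Rightarrow> real) \<Rightarrow> (real \<Rightarrow> real) \<Rightarrow> real \<Rightarrow> real" where
  "conv g h t = (LINT s:{0..t}|lebesgue. g (t - s) * h s)"

definition is_integral_resolvent :: "(real \<Rightarrow> real) \<Rightarrow> (real \<Rightarrow> real) \<Rightarrow> bool" where
  "is_integral_resolvent k r \<longleftrightarrow> r \<in> L1_loc \<and> ae_eq r (\<lambda>t. k t + conv r k t)"

definition solves_integral_equation ::
    "(real \<Rightarrow> real) \<Rightarrow> (real \<Rightarrow> real) \<Rightarrow> (real \<Rightarrow> real) \<Rightarrow> bool" where
  "solves_integral_equation k f x \<longleftrightarrow> x \<in> L1_loc \<and> ae_eq x (\<lambda>t. conv k x t + f t)"

definition Ces :: "(real \<Rightarrow> real) set" where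
  "Ces = {g \<in> L1_loc. \<exists>C::real. ((\<lambda>t. 1 / t * (LINT s:{0..t}|lebesgue. g s)) \<longlongrightarrow> C) at_top}"

end

theory Submission
  imports Defs
begin

text \<open>A locally integrable function \<open>g\<close> is a Cesaro function precisely when its primitive \<open>G\<close>,
  the integral of \<open>g\<close> over \<open>[0, t]\<close>, has a limit after division by \<open>t\<close>. Forming the primitive is convolution
  with the Heaviside function, so convolution with \<open>k\<close> commutes with it, and the equation for \<open>x\<close> integrates to
  \<open>X = k * X + F\<close>, which holds at every point. The resolvent identity \<open>r = k + r * k\<close> then gives
  \<open>r * X = k * X + r * (k * X) = (X - F) + r * (X - F)\<close>, that is \<open>X = F + r * F\<close> (lemma \<open>resolvent_formula\<close>).
  Thus each of \<open>X\<close> and \<open>F\<close> is obtained from the other by adding a convolution with an integrable kernel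
  (\<open>r\<close> or \<open>-k\<close>).

  Such a convolution preserves linear growth: if \<open>X(t) / t\<close> tends to \<open>C\<close>, then
  \<open>(k * X)(t) / t\<close>, the integral of \<open>k(s) X(t - s) / t\<close> over \<open>s\<close>, tends to \<open>C\<close> times the integral of \<open>k\<close>
  by dominated convergence (lemma \<open>line_conv_Cesaro_limit\<close>).

  Passing to primitives before convolving has a second benefit. A primitive is locally bounded, and the
  convolution of a locally integrable function with a locally bounded one converges absolutely at every
  point, so linearity and associativity are pointwise identities without exceptional null sets.

  Tonelli's theorem needs integrands measurable for the product of \<open>lborel\<close> with itself, so every
  function is first replaced by a Borel representative vanishing on the negative axis. Convolutions over
  \<open>[0, t]\<close> then become convolutions over the whole line.\<close>

section \<open>Convolution of Borel functions supported on the half-line\<close>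

definition causal :: "(real \<Rightarrow> real) \<Rightarrow> bool" where
  "causal g \<longleftrightarrow> g \<in> borel_measurable borel \<and> (\<forall>t<0. g t = 0) \<and>
     (\<forall>T. integrable lborel (\<lambda>t. indicator {..T} t * g t))"

definition locally_bounded :: "(real \<Rightarrow> real) \<Rightarrow> bool" where
  "locally_bounded g \<longleftrightarrow> (\<forall>T. \<exists>M. \<forall>t\<le>T. \<bar>g t\<bar> \<le> M)"

definition line_conv :: "(real \<Rightarrow> real) \<Rightarrow> (real \<Rightarrow> real) \<Rightarrow> real \<Rightarrow> real" where
  "line_conv a b t = (LINT s|lborel. a (t - s) * b s)"

definition heaviside :: "real \<Rightarrow> real" where
  "heaviside = indicator {0..}"

lemma integrable_reflect:
  fixes g :: "real \<Rightarrow> real"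
  assumes "integrable lborel g"
  shows "integrable lborel (\<lambda>s. g (t - s))"
  using lborel_integrable_real_affine[OF assms, of "-1" t] by simp

lemma integrable_reflect_causal:
  assumes "causal g"
  shows "integrable lborel (\<lambda>s. indicator {0..} s * g (t - s))"
proof -
  have "integrable lborel (\<lambda>s. indicator {..t} (t - s) * g (t - s))"
    using assms integrable_reflect[of "\<lambda>s. indicator {..t} s * g s" t]
    by (simp add: causal_def)
  moreover have "indicator {..t} (t - s) = (indicator {0..} s :: real)" for s
    by (simp add: indicator_def)
  ultimately show ?thesis by simp
qed

lemma integrable_causal_bounded:
  assumes g: "causal g" and c: "causal c" "locally_bounded c"
  shows "integrable lborel (\<lambda>s. g (t - s) * c s)"
proof -
  obtain M where M: "\<And>s. s \<le> t \<Longrightarrow> \<bar>c s\<bar> \<le> M"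
    using c(2) unfolding locally_bounded_def by metis
  have [measurable]: "g \<in> borel_measurable borel" "c \<in> borel_measurable borel"
    using g c by (auto simp: causal_def)
  show ?thesis
  proof (rule Bochner_Integration.integrable_bound)
    show "integrable lborel (\<lambda>s. M * (indicator {0..} s * g (t - s)))"
      using integrable_reflect_causal[OF g] by simp
    have "\<bar>g (t - s) * c s\<bar> \<le> \<bar>M * (indicator {0..} s * g (t - s))\<bar>" for s
    proof (cases "s < 0 \<or> s > t")
      case True
      then show ?thesis using g c by (auto simp: causal_def)
    next
      case False
      then have "\<bar>c s\<bar> \<le> \<bar>M\<bar>" using M[of s] by auto
      then have "\<bar>c s\<bar> * \<bar>g (t - s)\<bar> \<le> \<bar>M\<bar> * \<bar>g (t - s)\<bar>"
        by (rule mult_right_mono) simp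
      then show ?thesis using False by (simp add: abs_mult mult.commute)
    qed
    then show "AE s in lborel. norm (g (t - s) * c s) \<le> norm (M * (indicator {0..} s * g (t - s)))"
      by simp
  qed measurable
qed

text \<open>Tonelli: integrating first in \<open>u\<close> leaves the \<open>L1\<close> norm of \<open>a\<close> times \<open>\<bar>b\<bar>\<close>, by translation invariance.
  Every later exchange of integrals rests on this kernel.\<close>
lemma integrable_conv_kernel:
  fixes a b :: "real \<Rightarrow> real"
  assumes a: "integrable lborel a" and b: "integrable lborel b"
  shows "integrable (lborel \<Otimes>\<^sub>M lborel) (\<lambda>(s, u). a (u - s) * b s)"
proof (rule lborel_pair.Fubini_integrable)
  have [measurable]: "a \<in> borel_measurable borel" "b \<in> borel_measurable borel"
    using a b by (auto dest: borel_measurable_integrable)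
  show "(\<lambda>(s, u). a (u - s) * b s) \<in> borel_measurable (lborel \<Otimes>\<^sub>M lborel)"
    by measurable
  have *: "integrable lborel (\<lambda>u. a (u - s))" for s
    using lborel_integrable_real_affine[OF a, of 1 "-s"] by (simp add: add.commute)
  have "(LINT u|lborel. \<bar>a (u - s)\<bar>) = (LINT u|lborel. \<bar>a u\<bar>)" for s
    using lborel_integral_real_affine[of 1 "\<lambda>u. \<bar>a u\<bar>" "-s"] by (simp add: add.commute)
  then have "(\<lambda>s. LINT u|lborel. norm (case (s, u) of (s, u) \<Rightarrow> a (u - s) * b s)) =
      (\<lambda>s. (LINT u|lborel. \<bar>a u\<bar>) * \<bar>b s\<bar>)"
    by (simp add: abs_mult)
  then show "integrable lborel (\<lambda>s. LINT u|lborel. norm (case (s, u) of (s, u) \<Rightarrow> a (u - s) * b s))"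
    using b by simp
  show "AE s in lborel. integrable lborel (\<lambda>u. case (s, u) of (s, u) \<Rightarrow> a (u - s) * b s)"
    using * by simp
qed

lemma line_conv_commute: "line_conv a b t = line_conv b a t"
  unfolding line_conv_def
  using lborel_integral_real_affine[of "-1" "\<lambda>s. a (t - s) * b s" t]
  by (simp add: mult.commute)

lemma line_conv_negative:
  assumes "causal a" "causal b" "t < 0"
  shows "line_conv a b t = 0"
proof -
  have "(\<lambda>s. a (t - s) * b s) = (\<lambda>_. 0)"
  proof
    show "a (t - s) * b s = 0" for s
      using assms by (cases "s < 0") (auto simp: causal_def)
  qed
  then show ?thesis by (simp add: line_conv_def)
qed

text \<open>Up to time \<open>T\<close>, the convolution only sees \<open>a\<close> and \<open>b\<close> up to time \<open>T\<close>; so both may be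
  truncated there, and the truncations are integrable on the whole line.\<close>
lemma causal_line_conv:
  assumes a: "causal a" and b: "causal b"
  shows "causal (line_conv a b)"
  unfolding causal_def
proof (intro conjI allI impI)
  have [measurable]: "a \<in> borel_measurable borel" "b \<in> borel_measurable borel"
    using a b by (auto simp: causal_def)
  show "line_conv a b \<in> borel_measurable borel"
    unfolding line_conv_def[abs_def] by measurable
  show "line_conv a b t = 0" if "t < 0" for t
    using line_conv_negative[OF a b that] .
  fix T :: real
  let ?a = "\<lambda>t. indicator {..T} t * a t" and ?b = "\<lambda>t. indicator {..T} t * b t"
  have "integrable (lborel \<Otimes>\<^sub>M lborel) (\<lambda>(s, u). ?a (u - s) * ?b s)"
    using a b by (intro integrable_conv_kernel) (auto simp: causal_def)
  then have "integrable (lborel \<Otimes>\<^sub>M lborel) (\<lambda>(u, s). ?a (u - s) * ?b s)"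
    by (rule lborel_pair.integrable_product_swap[of "\<lambda>(s, u). ?a (u - s) * ?b s", simplified split_conv])
  then have "integrable lborel (\<lambda>u. LINT s|lborel. ?a (u - s) * ?b s)"
    by (rule lborel_pair.integrable_fst'[of "\<lambda>(u, s). ?a (u - s) * ?b s", simplified split_conv])
  then have "integrable lborel (\<lambda>u. indicator {..T} u * (LINT s|lborel. ?a (u - s) * ?b s))"
    by (subst mult.commute) (rule integrable_real_mult_indicator[rotated], simp_all)
  moreover have "indicator {..T} u * (LINT s|lborel. ?a (u - s) * ?b s) =
      indicator {..T} u * line_conv a b u" for u
  proof (cases "u \<le> T")
    case True
    have "?a (u - s) * ?b s = a (u - s) * b s" for s
    proof (cases "s < 0 \<or> s > u")
      case True
      then show ?thesis using a b by (auto simp: causal_def)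
    next
      case False
      then show ?thesis using \<open>u \<le> T\<close> by (simp add: indicator_def)
    qed
    then have "(\<lambda>s. ?a (u - s) * ?b s) = (\<lambda>s. a (u - s) * b s)" ..
    then show ?thesis by (simp only: line_conv_def)
  qed simp
  ultimately show "integrable lborel (\<lambda>u. indicator {..T} u * line_conv a b u)"
    by simp
qed

text \<open>Local boundedness of \<open>c\<close> makes the triple product absolutely integrable for each fixed \<open>t\<close>,
  hence the identity holds at every \<open>t\<close>: only \<open>0 \<le> u \<le> s \<le> t\<close> contributes, where \<open>c\<close> is bounded by a
  constant and the other two factors form a convolution kernel of integrable functions.\<close>
lemma line_conv_assoc:
  assumes a: "causal a" and b: "causal b" and c: "causal c" "locally_bounded c"
  shows "line_conv (line_conv a b) c t = line_conv a (line_conv b c) t"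
proof -
  have [measurable]: "a \<in> borel_measurable borel" "b \<in> borel_measurable borel"
      "c \<in> borel_measurable borel"
    using a b c by (auto simp: causal_def)
  obtain M where M: "\<And>s. s \<le> t \<Longrightarrow> \<bar>c s\<bar> \<le> M"
    using c(2) unfolding locally_bounded_def by metis
  \<comment> \<open>reflecting \<open>b\<close> turns \<open>b (s - u)\<close> into a function of \<open>u - s\<close>, the form of the kernel lemma\<close>
  let ?a = "\<lambda>s. indicator {0..} s * a (t - s)" and ?b = "\<lambda>v. indicator {..t} (-v) * b (-v)"
  have "integrable lborel ?a"
    by (rule integrable_reflect_causal[OF a])
  moreover have "integrable lborel ?b"
    using b integrable_reflect[of "\<lambda>s. indicator {..t} s * b s" 0]
    by (simp add: causal_def)
  ultimately have "integrable (lborel \<Otimes>\<^sub>M lborel) (\<lambda>(s, u). ?b (u - s) * ?a s)"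
    by (rule integrable_conv_kernel[rotated])
  then have *: "integrable (lborel \<Otimes>\<^sub>M lborel) (\<lambda>p. M * (case p of (s, u) \<Rightarrow> ?b (u - s) * ?a s))"
    by simp
  have "\<bar>a (t - s) * b (s - u) * c u\<bar> \<le> \<bar>M * (?b (u - s) * ?a s)\<bar>" for s u
  proof (cases "0 \<le> u \<and> u \<le> s \<and> s \<le> t")
    case True
    then have "\<bar>c u\<bar> \<le> \<bar>M\<bar>" using M[of u] by auto
    then have "\<bar>a (t - s) * b (s - u)\<bar> * \<bar>c u\<bar> \<le> \<bar>a (t - s) * b (s - u)\<bar> * \<bar>M\<bar>"
      by (rule mult_left_mono) simp
    then show ?thesis using True by (simp add: abs_mult mult_ac)
  next
    case False
    then show ?thesis using a b c by (auto simp: causal_def)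
  qed
  then have int: "integrable (lborel \<Otimes>\<^sub>M lborel) (\<lambda>(s, u). a (t - s) * b (s - u) * c u)"
    by (intro Bochner_Integration.integrable_bound[OF *]) (auto simp: split_beta')
  have shift: "line_conv a b (t - u) = (LINT s|lborel. a (t - s) * b (s - u))" for u
    unfolding line_conv_def
    using lborel_integral_real_affine[of 1 "\<lambda>s. a (t - u - s) * b s" "-u"]
    by (simp add: algebra_simps)
  have "line_conv (line_conv a b) c t = (LINT u|lborel. (LINT s|lborel. a (t - s) * b (s - u) * c u))"
    by (simp add: line_conv_def[of "line_conv a b"] shift)
  also have "\<dots> = (LINT s|lborel. (LINT u|lborel. a (t - s) * b (s - u) * c u))"
    using lborel_pair.Fubini_integral[OF int] .
  also have "\<dots> = line_conv a (line_conv b c) t"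
    by (simp add: line_conv_def mult.assoc)
  finally show ?thesis .
qed

lemma line_conv_diff_right:
  assumes "causal g" "causal c" "locally_bounded c" "causal d" "locally_bounded d"
  shows "line_conv g (\<lambda>s. c s - d s) t = line_conv g c t - line_conv g d t"
  unfolding line_conv_def
  using integrable_causal_bounded assms by (simp add: right_diff_distrib)

lemma line_conv_add_left:
  assumes "causal g" "causal h" "causal c" "locally_bounded c"
  shows "line_conv (\<lambda>s. g s + h s) c t = line_conv g c t + line_conv h c t"
  unfolding line_conv_def
  using integrable_causal_bounded assms by (simp add: distrib_right)

lemma AE_translate_reflect:
  fixes P :: "real \<Rightarrow> bool"
  assumes "AE s in lborel. P s"
  shows "AE s in lborel. P (t - s)"
proof -
  obtain N where N: "{s. \<not> P s} \<subseteq> N" "N \<in> sets borel" "emeasure lborel N = 0"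
    using AE_E[OF assms] by auto
  have "AE s in lborel. s \<notin> N"
    using N by (intro AE_not_in) auto
  then have "AE s in lborel. t + (-1) * s \<notin> N"
    using N(2) by (intro AE_borel_affine) auto
  then show "AE s in lborel. P (t - s)"
    by (rule eventually_mono) (use N(1) in auto)
qed

lemma line_conv_cong_AE:
  assumes "causal g" "causal h" "causal c" "AE s in lborel. g s = h s"
  shows "line_conv g c t = line_conv h c t"
proof -
  have [measurable]: "g \<in> borel_measurable borel" "h \<in> borel_measurable borel"
      "c \<in> borel_measurable borel"
    using assms by (auto simp: causal_def)
  show ?thesis
    unfolding line_conv_def
    by (rule integral_cong_AE) (use AE_translate_reflect[OF assms(4), of t] in auto)
qed

lemma causal_add:
  assumes "causal g" "causal h" shows "causal (\<lambda>t. g t + h t)"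
  using assms by (auto simp: causal_def distrib_left)

section \<open>Primitives and the resolvent formula\<close>

lemma causal_bounded_heaviside: "causal heaviside" "locally_bounded heaviside"
proof -
  have "indicator {..T} t * heaviside t = indicator {0..T} t" for t T
    by (auto simp: heaviside_def indicator_def)
  moreover have "integrable lborel (indicator {0..T} :: real \<Rightarrow> real)" for T :: real
    by (rule integrable_real_indicator) (auto simp: emeasure_lborel_Icc_eq)
  ultimately have "integrable lborel (\<lambda>t. indicator {..T} t * heaviside t)" for T
    by simp
  then show "causal heaviside"
    by (auto simp: causal_def) (auto simp: heaviside_def)
  have "\<bar>heaviside t\<bar> \<le> 1" for t
    by (simp add: heaviside_def indicator_def)
  then show "locally_bounded heaviside"
    unfolding locally_bounded_def by blast
qed

lemma line_conv_heaviside: "line_conv g heaviside t = (LINT s|lborel. indicator {..t} s * g s)"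
proof -
  have "heaviside (t - s) = indicator {..t} s" for s
    by (simp add: heaviside_def indicator_def)
  then show ?thesis
    unfolding line_conv_commute[of g] by (simp add: line_conv_def)
qed

lemma locally_bounded_primitive:
  assumes g: "causal g"
  shows "locally_bounded (line_conv g heaviside)"
  unfolding locally_bounded_def
proof
  fix T
  have int: "integrable lborel (\<lambda>s. indicator {..t} s * g s)" for t
    using g by (simp add: causal_def)
  have "\<bar>line_conv g heaviside t\<bar> \<le> (LINT s|lborel. \<bar>indicator {..T} s * g s\<bar>)" if "t \<le> T" for t
  proof -
    have "\<bar>line_conv g heaviside t\<bar> \<le> (LINT s|lborel. \<bar>indicator {..t} s * g s\<bar>)"
      unfolding line_conv_heaviside by (rule integral_abs_bound)
    also have "\<dots> \<le> (LINT s|lborel. \<bar>indicator {..T} s * g s\<bar>)"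
      using that int by (intro integral_mono) (auto simp: indicator_def)
    finally show ?thesis .
  qed
  then show "\<exists>M. \<forall>t\<le>T. \<bar>line_conv g heaviside t\<bar> \<le> M" by blast
qed

text \<open>Since \<open>X\<close> and \<open>F\<close> are locally bounded, linearity and associativity hold at every point, and the resolvent
  identity, known only almost everywhere, still yields a pointwise conclusion. The term \<open>r * X\<close> occurs on both sides of the computation and
  cancels.\<close>
lemma resolvent_formula:
  assumes k: "causal k" and r: "causal r"
    and X: "causal X" "locally_bounded X" and F: "causal F" "locally_bounded F"
    and reseq: "AE t in lborel. r t = k t + line_conv r k t"
    and eq: "\<And>t. X t = line_conv k X t + F t"
  shows "X t = F t + line_conv r F t"
proof -
  have kX: "line_conv k X = (\<lambda>t. X t - F t)"
    using eq by (auto simp: fun_eq_iff algebra_simps)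
  have rk: "causal (line_conv r k)"
    by (rule causal_line_conv[OF r k])
  have "line_conv r X t = line_conv (\<lambda>t. k t + line_conv r k t) X t"
    by (rule line_conv_cong_AE[OF r causal_add[OF k rk] X(1) reseq])
  also have "\<dots> = line_conv k X t + line_conv (line_conv r k) X t"
    by (rule line_conv_add_left[OF k rk X])
  also have "\<dots> = line_conv k X t + line_conv r (line_conv k X) t"
    using line_conv_assoc[OF r k X] by simp
  also have "\<dots> = X t - F t + (line_conv r X t - line_conv r F t)"
    unfolding kX using line_conv_diff_right[OF r X F] by simp
  finally show ?thesis by simp
qed

section \<open>Convolution with an integrable kernel and linear growth\<close>

text \<open>Dominated convergence: for fixed \<open>s\<close> the ratio \<open>X (t - s) / t\<close> has the same limit as \<open>X t / t\<close>, and for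
  \<open>t \<ge> 1\<close>, \<open>s \<ge> 0\<close> it is bounded by a constant. The bound combines the limit, which controls large
  arguments of \<open>X\<close>, with local boundedness, which controls the others.\<close>
lemma line_conv_Cesaro_limit:
  assumes k: "integrable lborel k" "\<And>t. t < 0 \<Longrightarrow> k t = 0"
    and X: "causal X" "locally_bounded X" and lim: "((\<lambda>t. X t / t) \<longlongrightarrow> C) at_top"
  shows "((\<lambda>t. line_conv k X t / t) \<longlongrightarrow> C * (LINT s|lborel. k s)) at_top"
proof -
  have [measurable]: "k \<in> borel_measurable borel" "X \<in> borel_measurable borel"
    using k X by (auto simp: causal_def)
  obtain T where T: "T \<ge> 1" "\<And>t. t \<ge> T \<Longrightarrow> \<bar>X t / t - C\<bar> < 1"
  proof -
    have "eventually (\<lambda>t. \<bar>X t / t - C\<bar> < 1) at_top"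
      using lim[THEN tendstoD, of 1] by (simp add: dist_real_def)
    then obtain T where "\<And>t. t \<ge> T \<Longrightarrow> \<bar>X t / t - C\<bar> < 1"
      by (auto simp: eventually_at_top_linorder)
    then show thesis by (intro that[of "max 1 T"]) auto
  qed
  obtain M where M: "\<And>t. t \<le> T \<Longrightarrow> \<bar>X t\<bar> \<le> M"
    using X(2) unfolding locally_bounded_def by metis
  have growth: "\<bar>X u / t\<bar> \<le> \<bar>C\<bar> + 1 + \<bar>M\<bar>" if "1 \<le> t" "u \<le> t" for u t
  proof (cases "u \<le> T")
    case True
    then have "\<bar>X u\<bar> \<le> \<bar>M\<bar>" using M[of u] by linarith
    also have "\<dots> \<le> \<bar>M\<bar> * t"
      using mult_left_mono[OF \<open>1 \<le> t\<close>, of "\<bar>M\<bar>"] by simp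
    finally have "\<bar>X u\<bar> \<le> \<bar>M\<bar> * t" .
    then have "\<bar>X u / t\<bar> \<le> \<bar>M\<bar>" using that by (simp add: field_simps)
    then show ?thesis by simp
  next
    case False
    then have "\<bar>X u / u\<bar> \<le> \<bar>C\<bar> + 1" using T(2)[of u] by linarith
    moreover have "\<bar>X u / t\<bar> \<le> \<bar>X u / u\<bar>"
      using that False T(1) by (auto simp: abs_divide intro!: divide_left_mono)
    ultimately show ?thesis by linarith
  qed
  have "((\<lambda>t. LINT s|lborel. X (t - s) / t * k s) \<longlongrightarrow> (LINT s|lborel. C * k s)) at_top"
  proof (rule integral_dominated_convergence_at_top)
    show "integrable lborel (\<lambda>s. (\<bar>C\<bar> + 1 + \<bar>M\<bar>) * \<bar>k s\<bar>)"
      using k by simp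
    show "\<forall>\<^sub>F t in at_top. AE s in lborel. norm (X (t - s) / t * k s) \<le> (\<bar>C\<bar> + 1 + \<bar>M\<bar>) * \<bar>k s\<bar>"
      using eventually_ge_at_top[of 1]
    proof eventually_elim
      case (elim t)
      have "norm (X (t - s) / t * k s) \<le> (\<bar>C\<bar> + 1 + \<bar>M\<bar>) * \<bar>k s\<bar>" for s
      proof (cases "s < 0")
        case False
        then show ?thesis
          using mult_right_mono[OF growth[of t "t - s"], of "\<bar>k s\<bar>"] elim
          by (simp add: abs_mult)
      qed (simp add: k)
      then show ?case by simp
    qed
    have "((\<lambda>t. X (t - s) / t * k s) \<longlongrightarrow> C * k s) at_top" for s
    proof -
      have shift: "filterlim (\<lambda>t. t - s) at_top at_top"
        using filterlim_tendsto_add_at_top[OF tendsto_const[of "-s"] filterlim_ident] by simp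
      have "((\<lambda>t. X (t - s) / (t - s)) \<longlongrightarrow> C) at_top"
        using filterlim_compose[OF lim shift] .
      moreover have "((\<lambda>t. 1 - s / t) \<longlongrightarrow> 1 - 0) at_top"
        by (intro tendsto_diff tendsto_const real_tendsto_divide_at_top[OF tendsto_const] filterlim_ident)
      ultimately have "((\<lambda>t. X (t - s) / (t - s) * (1 - s / t)) \<longlongrightarrow> C * (1 - 0)) at_top"
        by (rule tendsto_mult)
      moreover have "\<forall>\<^sub>F t in at_top. X (t - s) / (t - s) * (1 - s / t) = X (t - s) / t"
        using eventually_gt_at_top[of "max 0 s"]
        by eventually_elim (simp add: diff_divide_eq_iff)
      ultimately have "((\<lambda>t. X (t - s) / t) \<longlongrightarrow> C) at_top"
        using filterlim_cong[OF refl refl] by fastforce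
      then show ?thesis by (intro tendsto_intros)
    qed
    then show "AE s in lborel. ((\<lambda>t. X (t - s) / t * k s) \<longlongrightarrow> C * k s) at_top"
      by simp
  qed measurable
  moreover have "(LINT s|lborel. X (t - s) / t * k s) = line_conv k X t / t" for t
    using line_conv_commute[of k X t] by (simp add: line_conv_def[of X])
  ultimately show ?thesis by (simp only: integral_mult_right_zero)
qed

section \<open>Borel representatives\<close>

definition represents :: "(real \<Rightarrow> real) \<Rightarrow> (real \<Rightarrow> real) \<Rightarrow> bool" where
  "represents g' g \<longleftrightarrow> causal g' \<and> ae_eq g g'"

lemma lebesgue_borel_transfer:
  fixes g h :: "real \<Rightarrow> real"
  assumes h: "h \<in> borel_measurable borel" and eq: "AE s in lborel. h s = g s"
  shows "integrable lebesgue g \<longleftrightarrow> integrable lborel h"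
    and "integral\<^sup>L lebesgue g = integral\<^sup>L lborel h"
proof -
  have eq': "AE s in lebesgue. h s = g s"
    using eq by (rule AE_completion)
  have hm: "h \<in> borel_measurable lborel" and hl: "h \<in> borel_measurable lebesgue"
    using h by (auto intro: measurable_completion)
  have gl: "g \<in> borel_measurable lebesgue"
    using borel_measurable_AE[OF hl eq'] .
  show "integrable lebesgue g \<longleftrightarrow> integrable lborel h"
    using integrable_cong_AE[OF hl gl eq'] integrable_completion[OF hm] by simp
  show "integral\<^sup>L lebesgue g = integral\<^sup>L lborel h"
    using integral_cong_AE[OF hl gl eq'] integral_completion[OF hm] by simp
qed

lemma ae_eq_lborel: "ae_eq g h \<longleftrightarrow> (AE t in lborel. 0 \<le> t \<longrightarrow> g t = h t)"
  by (simp add: ae_eq_def AE_completion_iff)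

text \<open>A function in \<open>L1_loc\<close> is only known to be Lebesgue measurable on each \<open>[0, T]\<close>. Exhausting the half-line
  by \<open>[0, n]\<close> gives measurability there, and a Lebesgue measurable function agrees almost everywhere
  with a Borel one.\<close>
lemma L1_loc_represented:
  assumes "g \<in> L1_loc"
  obtains g' where "represents g' g"
proof -
  have int: "set_integrable lebesgue {0..T} g" for T
    using assms by (auto simp: L1_loc_def)
  have "(\<lambda>s. indicator {0..} s * g s) \<in> borel_measurable lebesgue"
  proof (rule borel_measurable_LIMSEQ_real)
    show "(\<lambda>s. indicator {0..real n} s * g s) \<in> borel_measurable lebesgue" for n
      using int[of "real n"] by (auto simp: set_integrable_def dest: borel_measurable_integrable)
    fix s :: real
    have "\<forall>\<^sub>F n in sequentially. indicator {0..} s * g s = indicator {0..real n} s * g s"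
      using eventually_ge_at_top[of "nat \<lceil>s\<rceil>"]
      by eventually_elim (auto simp: indicator_def nat_le_iff ceiling_le_iff)
    then show "(\<lambda>n. indicator {0..real n} s * g s) \<longlonglongrightarrow> indicator {0..} s * g s"
      by (rule Lim_transform_eventually[OF tendsto_const])
  qed
  then obtain h where h [measurable]: "h \<in> borel_measurable borel"
    and eq: "AE s in lborel. indicator {0..} s * g s = h s"
    using completion_ex_borel_measurable_real[of _ lborel] by auto
  define g' where "g' = (\<lambda>s. indicator {0..} s * h s)"
  have g' [measurable]: "g' \<in> borel_measurable borel"
    unfolding g'_def by measurable
  have gg': "AE s in lborel. 0 \<le> s \<longrightarrow> g s = g' s"
    using eq by (rule eventually_mono) (auto simp: g'_def indicator_def)
  have "integrable lborel (\<lambda>s. indicator {..T} s * g' s)" for T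
  proof (rule lebesgue_borel_transfer(1)[THEN iffD1])
    show "AE s in lborel. indicator {..T} s * g' s = indicator {0..T} s * g s"
      using gg' by (rule eventually_mono) (auto simp: g'_def indicator_def)
    show "integrable lebesgue (\<lambda>s. indicator {0..T} s * g s)"
      using int[of T] by (simp add: set_integrable_def)
  qed measurable
  then have "represents g' g"
    using gg' by (simp add: represents_def causal_def ae_eq_lborel) (simp add: g'_def)
  then show thesis by (rule that)
qed

lemma represents_primitive:
  assumes "represents g' g"
  shows "(LINT s:{0..t}|lebesgue. g s) = line_conv g' heaviside t"
  unfolding line_conv_heaviside set_lebesgue_integral_def
proof (rule lebesgue_borel_transfer(2))
  have [measurable]: "g' \<in> borel_measurable borel" and neg: "\<And>s. s < 0 \<Longrightarrow> g' s = 0"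
    using assms by (auto simp: represents_def causal_def)
  show "(\<lambda>s. indicator {..t} s * g' s) \<in> borel_measurable borel"
    by measurable
  have "AE s in lborel. 0 \<le> s \<longrightarrow> g s = g' s"
    using assms by (simp add: represents_def ae_eq_lborel)
  then show "AE s in lborel. indicator {..t} s * g' s = indicator {0..t} s *\<^sub>R g s"
    by (rule eventually_mono) (use neg in \<open>auto simp: indicator_def not_le\<close>)
qed

text \<open>Equality holds for every \<open>t\<close>, since reflection and translation preserve null sets. This includes points
  where the integrand is not integrable, because both sides then take the same default value.\<close>
lemma represents_conv:
  assumes a: "represents a' a" and b: "represents b' b"
  shows "conv a b t = line_conv a' b' t"
  unfolding line_conv_def conv_def set_lebesgue_integral_def
proof (rule lebesgue_borel_transfer(2))
  have [measurable]: "a' \<in> borel_measurable borel" "b' \<in> borel_measurable borel"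
    and neg: "\<And>s. s < 0 \<Longrightarrow> a' s = 0" "\<And>s. s < 0 \<Longrightarrow> b' s = 0"
    using a b by (auto simp: represents_def causal_def)
  show "(\<lambda>s. a' (t - s) * b' s) \<in> borel_measurable borel"
    by measurable
  have "AE s in lborel. 0 \<le> t - s \<longrightarrow> a (t - s) = a' (t - s)"
    using a by (intro AE_translate_reflect) (simp add: represents_def ae_eq_lborel)
  moreover have "AE s in lborel. 0 \<le> s \<longrightarrow> b s = b' s"
    using b by (simp add: represents_def ae_eq_lborel)
  ultimately show "AE s in lborel. a' (t - s) * b' s = indicator {0..t} s *\<^sub>R (a (t - s) * b s)"
    by eventually_elim (use neg in \<open>auto simp: indicator_def not_le\<close>)
qed

lemma L1_subset_L1_loc: "L1 \<subseteq> L1_loc"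
  by (auto simp: L1_def L1_loc_def intro: set_integrable_subset lmeasurable_compact
      fmeasurableD)

lemma represents_L1_integrable:
  assumes "represents g' g" "g \<in> L1"
  shows "integrable lborel g'"
proof (rule lebesgue_borel_transfer(1)[THEN iffD1])
  show "g' \<in> borel_measurable borel"
    using assms by (simp add: represents_def causal_def)
  show "integrable lebesgue (\<lambda>s. indicator {0..} s *\<^sub>R g s)"
    using assms by (simp add: L1_def set_integrable_def)
  have neg: "\<And>s. s < 0 \<Longrightarrow> g' s = 0"
    using assms by (simp add: represents_def causal_def)
  have "AE s in lborel. 0 \<le> s \<longrightarrow> g s = g' s"
    using assms by (simp add: represents_def ae_eq_lborel)
  then show "AE s in lborel. g' s = indicator {0..} s *\<^sub>R g s"
    by (rule eventually_mono) (use neg in \<open>auto simp: indicator_def not_le\<close>)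
qed

lemma Ces_iff_primitive:
  assumes "g \<in> L1_loc" "represents g' g"
  shows "g \<in> Ces \<longleftrightarrow> (\<exists>C. ((\<lambda>t. line_conv g' heaviside t / t) \<longlongrightarrow> C) at_top)"
  using assms(1) by (simp add: Ces_def represents_primitive[OF assms(2)])

text \<open>Both the equation for \<open>x\<close> and the one for the resolvent have this shape. Vanishing on the negative axis
  extends the equality from the half-line to almost all of the line.\<close>
lemma represented_equation:
  assumes "represents u' u" "represents v' v" "represents a' a" "represents b' b"
    and "ae_eq u (\<lambda>t. v t + conv a b t)"
  shows "AE t in lborel. u' t = v' t + line_conv a' b' t"
proof -
  have neg: "u' t = v' t + line_conv a' b' t" if "t < 0" for t
    using assms that by (simp add: represents_def line_conv_negative) (simp add: causal_def)
  have "AE t in lborel. 0 \<le> t \<longrightarrow> u t = u' t" "AE t in lborel. 0 \<le> t \<longrightarrow> v t = v' t"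
    "AE t in lborel. 0 \<le> t \<longrightarrow> u t = v t + line_conv a' b' t"
    using assms by (simp_all add: represents_def ae_eq_lborel represents_conv[OF assms(3,4)])
  then show ?thesis
  proof eventually_elim
    case (elim t)
    then show ?case using neg[of t] by (cases "t < 0") auto
  qed
qed

section \<open>Cesaro functions and the integral equation\<close>

theorem mainTheorem3:
  fixes k r f x :: "real \<Rightarrow> real"
  assumes "k \<in> L1"
    and "is_integral_resolvent k r"
    and "r \<in> L1"
    and "f \<in> L1_loc"
    and "solves_integral_equation k f x"
  shows "f \<in> Ces \<longleftrightarrow> x \<in> Ces"
proof -
  have xL: "x \<in> L1_loc" and xeq: "ae_eq x (\<lambda>t. f t + conv k x t)"
    using assms(5) by (simp_all add: solves_integral_equation_def add.commute)
  have req: "ae_eq r (\<lambda>t. k t + conv r k t)"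
    using assms(2) by (simp add: is_integral_resolvent_def)
  obtain k' r' f' x' where rep: "represents k' k" "represents r' r" "represents f' f" "represents x' x"
    using L1_loc_represented assms(1,3,4) xL L1_subset_L1_loc by (metis subsetD)
  then have caus: "causal k'" "causal r'" "causal f'" "causal x'"
    by (simp_all add: represents_def)
  have int: "integrable lborel k'" "integrable lborel r'"
    using represents_L1_integrable rep assms by blast+
  define X F where "X = line_conv x' heaviside" and "F = line_conv f' heaviside"
  have X: "causal X" "locally_bounded X" and F: "causal F" "locally_bounded F"
    unfolding X_def F_def
    using caus by (simp_all add: causal_line_conv causal_bounded_heaviside locally_bounded_primitive)
  have X_eq: "X t = line_conv k' X t + F t" for t
  proof -
    have kx: "causal (line_conv k' x')"
      using causal_line_conv caus by blast
    have "X t = line_conv (\<lambda>t. f' t + line_conv k' x' t) heaviside t"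
      unfolding X_def
      by (rule line_conv_cong_AE[OF caus(4) causal_add[OF caus(3) kx] causal_bounded_heaviside(1)
            represented_equation[OF rep(4) rep(3) rep(1) rep(4) xeq]])
    also have "\<dots> = F t + line_conv k' X t"
      by (simp add: line_conv_add_left[OF caus(3) kx causal_bounded_heaviside] F_def X_def
          line_conv_assoc[OF caus(1) caus(4) causal_bounded_heaviside])
    finally show ?thesis by simp
  qed
  have X_from_F: "X t = F t + line_conv r' F t" for t
    by (rule resolvent_formula[OF caus(1,2) X F
          represented_equation[OF rep(2) rep(1) rep(2) rep(1) req] X_eq])
  have neg: "k' t = 0" "r' t = 0" if "t < 0" for t
    using caus that by (simp_all add: causal_def)
  have "(\<exists>C. ((\<lambda>t. F t / t) \<longlongrightarrow> C) at_top) \<longleftrightarrow> (\<exists>C. ((\<lambda>t. X t / t) \<longlongrightarrow> C) at_top)"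
  proof
    assume "\<exists>C. ((\<lambda>t. F t / t) \<longlongrightarrow> C) at_top"
    then obtain C where "((\<lambda>t. F t / t) \<longlongrightarrow> C) at_top" ..
    then have "((\<lambda>t. F t / t + line_conv r' F t / t) \<longlongrightarrow> C + C * (LINT s|lborel. r' s)) at_top"
      by (intro tendsto_add line_conv_Cesaro_limit int F) (use neg in auto)
    moreover have "F t / t + line_conv r' F t / t = X t / t" for t
      by (simp add: X_from_F add_divide_distrib)
    ultimately show "\<exists>C. ((\<lambda>t. X t / t) \<longlongrightarrow> C) at_top"
      by auto
  next
    assume "\<exists>C. ((\<lambda>t. X t / t) \<longlongrightarrow> C) at_top"
    then obtain C where "((\<lambda>t. X t / t) \<longlongrightarrow> C) at_top" ..
    then have "((\<lambda>t. X t / t - line_conv k' X t / t) \<longlongrightarrow> C - C * (LINT s|lborel. k' s)) at_top"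
      by (intro tendsto_diff line_conv_Cesaro_limit int X) (use neg in auto)
    moreover have "X t / t - line_conv k' X t / t = F t / t" for t
      using X_eq[of t] by (simp add: diff_divide_distrib [symmetric])
    ultimately show "\<exists>C. ((\<lambda>t. F t / t) \<longlongrightarrow> C) at_top"
      by auto
  qed
  then show ?thesis
    using Ces_iff_primitive[OF assms(4) rep(3)] Ces_iff_primitive[OF xL rep(4)]
    by (simp add: X_def F_def)
qed

end
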